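(* Let $(D,\prec_\lambda,\succ_\lambda,\alpha,\beta)$ be a BiHom-dendriform conformal algebra and let $R:D\to D$ be a Rota-Baxter operator of weight $0$ on $D$. Define operations on $D$ by $p\searrow_\lambda^R q=R(p)\succ_\lambda q$, $p\nearrow_\lambda^R q=p\succ_\lambda R(q)$, $p\swarrow_\lambda^R q=R(p)\prec_\lambda q$ and $p\nwarrow_\lambda^R q=p\prec_\lambda R(q)$ for all $p,q\in D$. Then $(D,\nwarrow_\lambda^R,\swarrow_\lambda^R,\nearrow_\lambda^R,\searrow_\lambda^R,\alpha,\beta)$ is a BiHom-quadri-conformal algebra.
   Context: All vector spaces, linear maps and tensor products are over $\mathbb{C}$; $\lambda,\mu$ are formal variables. For a $\mathbb{C}[\partial]$-module $A$ put $A[\lambda]=\mathbb{C}[\lambda]\otimes A$. A $\mathbb{C}$-bilinear map $A\otimes A\to A[\lambda]$, $p\otimes q\mapsto p\circ_\lambda q$, is conformal sesquilinear if $(\partial p)\circ_\lambda q=-\lambda(p\circ_\lambda q)$ and $p\circ_\lambda(\partial q)=(\partial+\lambda)(p\circ_\lambda q)$. Linear maps and products are extended coefficientwise to polynomials in $\lambda,\mu$; e.g. if $p\circ_\lambda q=\sum_i\lambda^i a_i$ then $(p\circ_\lambda q)\circ_{\lambda+\mu}r=\sum_i\lambda^i(a_i\circ_{\lambda+\mu}r)$. A map $\alpha$ is multiplicative for $\circ_\lambda$ if $\alpha(p\circ_\lambda q)=\alpha(p)\circ_\lambda\alpha(q)$. A BiHom-dendriform conformal algebra $(D,\prec_\lambda,\succ_\lambda,\alpha,\beta)$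 is a $\mathbb{C}[\partial]$-module $D$ with conformal sesquilinear maps $\prec_\lambda,\succ_\lambda:D\otimes D\to D[\lambda]$ and commuting $\mathbb{C}$-linear maps $\alpha,\beta:D\to D$ commuting with $\partial$ and multiplicative for both products, such that for all $p,q,r\in D$: $(p\prec_\lambda q)\prec_{\lambda+\mu}\beta(r)=\alpha(p)\prec_\lambda(q\prec_\mu r+q\succ_\mu r)$; $(p\succ_\lambda q)\prec_{\lambda+\mu}\beta(r)=\alpha(p)\succ_\lambda(q\prec_\mu r)$; $\alpha(p)\succ_\lambda(q\succ_\mu r)=(p\prec_\lambda q+p\succ_\lambda q)\succ_{\lambda+\mu}\beta(r)$. A Rota-Baxter operator of weight $0$ on $D$ is a $\mathbb{C}[\partial]$-linear map $R:D\to D$ with $R\alpha=\alpha R$, $R\beta=\beta R$, $R(p)\succ_\lambda R(q)=R(p\succ_\lambda R(q)+R(p)\succ_\lambda q)$ and $R(p)\prec_\lambda R(q)=R(p\prec_\lambda R(q)+R(p)\prec_\lambda q)$ for all $p,q\in D$. A BiHom-quadri-conformal algebra $(Q,\nwarrow_\lambda,\swarrow_\lambda,\nearrow_\lambda,\searrow_\lambda,\alpha,\beta)$ is a $\mathbb{C}[\partial]$-module $Q$ with four conformal sesquilinear maps $\nwarrow_\lambda,\swarrow_\lambda,\nearrow_\lambda,\searrow_\lambda:Q\otimes Q\to Q[\lambda]$ and commuting $\mathbb{C}$-linear maps $\alpha,\beta:Q\to Q$ commuting with $\partial$ and multiplicative for all four products, such that, writing (in $Q$) $p\prec_\lambda q=p\nwarrow_\lambda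 q+p\swarrow_\lambda q$, $p\succ_\lambda q=p\nearrow_\lambda q+p\searrow_\lambda q$, $p\vee_\lambda q=p\searrow_\lambda q+p\swarrow_\lambda q$, $p\wedge_\lambda q=p\nearrow_\lambda q+p\nwarrow_\lambda q$ and $p*_\lambda q=p\nwarrow_\lambda q+p\swarrow_\lambda q+p\nearrow_\lambda q+p\searrow_\lambda q$, for all $p,q,r\in Q$: $(p\nwarrow_\lambda q)\nwarrow_{\lambda+\mu}\beta(r)=\alpha(p)\nwarrow_\lambda(q*_\mu r)$; $(p\nearrow_\lambda q)\nwarrow_{\lambda+\mu}\beta(r)=\alpha(p)\nearrow_\lambda(q\prec_\mu r)$; $(p\wedge_\lambda q)\nearrow_{\lambda+\mu}\beta(r)=\alpha(p)\nearrow_\lambda(q\succ_\mu r)$; $(p\swarrow_\lambda q)\nwarrow_{\lambda+\mu}\beta(r)=\alpha(p)\swarrow_\lambda(q\wedge_\mu r)$; $(p\vee_\lambda q)\nearrow_{\lambda+\mu}\beta(r)=\alpha(p)\searrow_\lambda(q\nearrow_\mu r)$; $(p\searrow_\lambda q)\nwarrow_{\lambda+\mu}\beta(r)=\alpha(p)\searrow_\lambda(q\nwarrow_\mu r)$; $(p\prec_\lambda q)\swarrow_{\lambda+\mu}\beta(r)=\alpha(p)\swarrow_\lambda(q\vee_\mu r)$; $(p*_\lambda q)\searrow_{\lambda+\mu}\beta(r)=\alpha(p)\searrow_\lambda(q\searrow_\mu r)$; $(p\succ_\lambda q)\swarrow_{\lambda+\mu}\beta(r)=\alpha(p)\searrow_\lambda(q\swarrow_\mu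 r)$. *)

theory Defs
  imports Complex_Main "HOL-Computational_Algebra.Polynomial"
begin

text \<open>
  A \<open>\<complex>[\<partial>]\<close>-module is a module in the sense of \<^locale>\<open>module\<close> over the ring \<^typ>\<open>complex poly\<close>
  (the carrier is a whole type), so \<open>\<partial>\<close> acts as the polynomial \<^term>\<open>[:0, 1:] :: complex poly\<close>
  and a scalar \<open>c\<close> as the constant polynomial \<^term>\<open>[:c:] :: complex poly\<close>.
\<close>

definition partial_op :: "(complex poly \<Rightarrow> 'a \<Rightarrow> 'a) \<Rightarrow> 'a \<Rightarrow> 'a"
  where "partial_op scale = scale [:0, 1:]"

definition cscale :: "(complex poly \<Rightarrow> 'a \<Rightarrow> 'a) \<Rightarrow> complex \<Rightarrow> 'a \<Rightarrow> 'a"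
  where "cscale scale c = scale [:c:]"

text \<open>
  \<open>A[\<lambda>]\<close> is the type \<^typ>\<open>'a poly\<close>; multiplication by \<open>\<lambda>\<close> is \<^term>\<open>pCons 0\<close>, and linear maps
  act coefficientwise through \<^const>\<open>map_poly\<close>.
\<close>

definition poly_cscale ::
    "(complex poly \<Rightarrow> 'a::ab_group_add \<Rightarrow> 'a) \<Rightarrow> complex \<Rightarrow> 'a poly \<Rightarrow> 'a poly"
  where "poly_cscale scale c = map_poly (cscale scale c)"

definition conformal_sesquilinear ::
    "(complex poly \<Rightarrow> 'a::ab_group_add \<Rightarrow> 'a) \<Rightarrow> ('a \<Rightarrow> 'a \<Rightarrow> 'a poly) \<Rightarrow> bool"
  where "conformal_sesquilinear scale f \<longleftrightarrow>
    (\<forall>q. Vector_Spaces.linear (cscale scale) (poly_cscale scale) (\<lambda>p. f p q)) \<and>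
    (\<forall>p. Vector_Spaces.linear (cscale scale) (poly_cscale scale) (\<lambda>q. f p q)) \<and>
    (\<forall>p q. f (partial_op scale p) q = - pCons 0 (f p q)) \<and>
    (\<forall>p q. f p (partial_op scale q) = map_poly (partial_op scale) (f p q) + pCons 0 (f p q))"

definition multiplicative :: "('a::zero \<Rightarrow> 'a) \<Rightarrow> ('a \<Rightarrow> 'a \<Rightarrow> 'a poly) \<Rightarrow> bool"
  where "multiplicative \<alpha> f \<longleftrightarrow> (\<forall>p q. map_poly \<alpha> (f p q) = f (\<alpha> p) (\<alpha> q))"

text \<open>
  \<open>A[\<lambda>,\<mu>]\<close> is \<^typ>\<open>'a poly poly\<close>, with outer variable \<open>\<lambda>\<close> and inner variable \<open>\<mu>\<close>.
  A polynomial in \<open>\<lambda>, \<mu>\<close> is represented by the operator of multiplication by it; those for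
  \<open>\<lambda>\<close>, \<open>\<mu>\<close> and \<open>\<lambda> + \<mu>\<close> follow.
\<close>

definition mult_lam :: "'a::ab_group_add poly poly \<Rightarrow> 'a poly poly"
  where "mult_lam P = pCons 0 P"

definition mult_mu :: "'a::ab_group_add poly poly \<Rightarrow> 'a poly poly"
  where "mult_mu P = map_poly (pCons 0) P"

definition mult_lam_mu :: "'a::ab_group_add poly poly \<Rightarrow> 'a poly poly"
  where "mult_lam_mu P = mult_lam P + mult_mu P"

text \<open>
  For \<open>P = \<Sum>\<^sub>i x\<^sup>i a\<^sub>i\<close> and \<open>X\<close> multiplication by a polynomial \<open>\<xi>(\<lambda>,\<mu>)\<close>,
  \<open>coeffwise X g P = \<Sum>\<^sub>i \<xi>\<^sup>i g(a\<^sub>i)\<close>.  In particular \<open>subst_var X P\<close> is \<open>P\<close> with \<open>\<xi>\<close>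
  substituted for the variable.
\<close>

definition coeffwise ::
    "('a poly poly \<Rightarrow> 'a poly poly) \<Rightarrow> ('a \<Rightarrow> 'a poly poly) \<Rightarrow> 'a::ab_group_add poly \<Rightarrow> 'a poly poly"
  where "coeffwise X g P = (\<Sum>i\<le>degree P. (X ^^ i) (g (coeff P i)))"

definition subst_var ::
    "('a poly poly \<Rightarrow> 'a poly poly) \<Rightarrow> 'a::ab_group_add poly \<Rightarrow> 'a poly poly"
  where "subst_var X P = coeffwise X (\<lambda>a. [:[:a:]:]) P"

text \<open>
  \<open>lext f P r\<close> is \<open>P(\<lambda>) f\<^bsub>\<lambda>+\<mu>\<^esub> r\<close> and \<open>rext f p Q\<close> is \<open>p f\<^bsub>\<lambda>\<^esub> Q(\<mu>)\<close>, so that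
  \<open>lext g (f p q) r\<close> is \<open>(p f\<^bsub>\<lambda>\<^esub> q) g\<^bsub>\<lambda>+\<mu>\<^esub> r\<close> and \<open>rext g p (f q r)\<close> is
  \<open>p g\<^bsub>\<lambda>\<^esub> (q f\<^bsub>\<mu>\<^esub> r)\<close>.
\<close>

definition lext ::
    "('a \<Rightarrow> 'a \<Rightarrow> 'a poly) \<Rightarrow> 'a::ab_group_add poly \<Rightarrow> 'a \<Rightarrow> 'a poly poly"
  where "lext f P r = coeffwise mult_lam (\<lambda>a. subst_var mult_lam_mu (f a r)) P"

definition rext ::
    "('a \<Rightarrow> 'a \<Rightarrow> 'a poly) \<Rightarrow> 'a \<Rightarrow> 'a::ab_group_add poly \<Rightarrow> 'a poly poly"
  where "rext f p Q = coeffwise mult_mu (\<lambda>b. subst_var mult_lam (f p b)) Q"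

locale bihom_module = module scale
  for scale :: "complex poly \<Rightarrow> 'a::ab_group_add \<Rightarrow> 'a" +
  fixes \<alpha> \<beta> :: "'a \<Rightarrow> 'a"
  assumes linear_alpha: "Vector_Spaces.linear (cscale scale) (cscale scale) \<alpha>"
    and linear_beta: "Vector_Spaces.linear (cscale scale) (cscale scale) \<beta>"
    and alpha_beta: "\<alpha> (\<beta> p) = \<beta> (\<alpha> p)"
    and alpha_partial: "\<alpha> (partial_op scale p) = partial_op scale (\<alpha> p)"
    and beta_partial: "\<beta> (partial_op scale p) = partial_op scale (\<beta> p)"

locale bihom_dendriform_conformal = bihom_module scale \<alpha> \<beta>
  for scale :: "complex poly \<Rightarrow> 'a::ab_group_add \<Rightarrow> 'a"
    and prec succ :: "'a \<Rightarrow> 'a \<Rightarrow> 'a poly"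
    and \<alpha> \<beta> :: "'a \<Rightarrow> 'a" +
  assumes sesquilinear_prec: "conformal_sesquilinear scale prec"
    and sesquilinear_succ: "conformal_sesquilinear scale succ"
    and multiplicative_alpha: "multiplicative \<alpha> prec" "multiplicative \<alpha> succ"
    and multiplicative_beta: "multiplicative \<beta> prec" "multiplicative \<beta> succ"
    and prec_prec: "lext prec (prec p q) (\<beta> r) = rext prec (\<alpha> p) (prec q r + succ q r)"
    and succ_prec: "lext prec (succ p q) (\<beta> r) = rext succ (\<alpha> p) (prec q r)"
    and succ_succ: "rext succ (\<alpha> p) (succ q r) = lext succ (prec p q + succ p q) (\<beta> r)"

locale rota_baxter_weight_0 = module_hom scale scale R
  for scale :: "complex poly \<Rightarrow> 'a::ab_group_add \<Rightarrow> 'a"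
    and prec succ :: "'a \<Rightarrow> 'a \<Rightarrow> 'a poly"
    and \<alpha> \<beta> R :: "'a \<Rightarrow> 'a" +
  assumes R_alpha: "R (\<alpha> p) = \<alpha> (R p)"
    and R_beta: "R (\<beta> p) = \<beta> (R p)"
    and R_succ: "succ (R p) (R q) = map_poly R (succ p (R q) + succ (R p) q)"
    and R_prec: "prec (R p) (R q) = map_poly R (prec p (R q) + prec (R p) q)"

text \<open>
  \<open>nw, sw, ne, se\<close> are the products \<open>\<nwarrow>, \<swarrow>, \<nearrow>, \<searrow>\<close>.  The five sums introduced by
  \<open>defines\<close> are expanded in the locale predicate and are not arguments of it.
\<close>

locale bihom_quadri_conformal = bihom_module scale \<alpha> \<beta>
  for scale :: "complex poly \<Rightarrow> 'a::ab_group_add \<Rightarrow> 'a"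
    and nw sw ne se :: "'a \<Rightarrow> 'a \<Rightarrow> 'a poly"
    and \<alpha> \<beta> :: "'a \<Rightarrow> 'a" +
  fixes prec succ vee wedge star :: "'a \<Rightarrow> 'a \<Rightarrow> 'a poly"
  defines "prec \<equiv> \<lambda>p q. nw p q + sw p q"
    and "succ \<equiv> \<lambda>p q. ne p q + se p q"
    and "vee \<equiv> \<lambda>p q. se p q + sw p q"
    and "wedge \<equiv> \<lambda>p q. ne p q + nw p q"
    and "star \<equiv> \<lambda>p q. nw p q + sw p q + ne p q + se p q"
  assumes sesquilinear:
      "conformal_sesquilinear scale nw" "conformal_sesquilinear scale sw"
      "conformal_sesquilinear scale ne" "conformal_sesquilinear scale se"
    and multiplicative_alpha:
      "multiplicative \<alpha> nw" "multiplicative \<alpha> sw" "multiplicative \<alpha> ne" "multiplicative \<alpha> se"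
    and multiplicative_beta:
      "multiplicative \<beta> nw" "multiplicative \<beta> sw" "multiplicative \<beta> ne" "multiplicative \<beta> se"
    and nw_nw: "lext nw (nw p q) (\<beta> r) = rext nw (\<alpha> p) (star q r)"
    and ne_nw: "lext nw (ne p q) (\<beta> r) = rext ne (\<alpha> p) (prec q r)"
    and wedge_ne: "lext ne (wedge p q) (\<beta> r) = rext ne (\<alpha> p) (succ q r)"
    and sw_nw: "lext nw (sw p q) (\<beta> r) = rext sw (\<alpha> p) (wedge q r)"
    and vee_ne: "lext ne (vee p q) (\<beta> r) = rext se (\<alpha> p) (ne q r)"
    and se_nw: "lext nw (se p q) (\<beta> r) = rext se (\<alpha> p) (nw q r)"
    and prec_sw: "lext sw (prec p q) (\<beta> r) = rext sw (\<alpha> p) (vee q r)"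
    and star_se: "lext se (star p q) (\<beta> r) = rext se (\<alpha> p) (se q r)"
    and succ_sw: "lext sw (succ p q) (\<beta> r) = rext se (\<alpha> p) (sw q r)"

end

theory Submission
  imports Defs
begin

text \<open>
  Each of the four products is one of the dendriform products with \<open>R\<close> applied to one argument.
  The extensions to polynomials turn this into the same extension of the dendriform product, with
  \<open>R\<close> applied either to the element argument or coefficientwise to the polynomial argument
  (lemmas \<open>lext_comp_left\<close> and \<open>rext_comp_right\<close>).  A polynomial to which \<open>R\<close> is applied is always
  one of the sums \<open>p \<prec> R q + R p \<prec> q\<close>, \<open>p \<succ> R q + R p \<succ> q\<close> or the sum of both, which the
  Rota-Baxter identities collapse to \<open>R p \<prec> R q\<close>, \<open>R p \<succ> R q\<close> or the sum of these.  Each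
  of the nine quadri identities thereby becomes a dendriform identity for a triple in which \<open>R\<close>
  has been applied to two of \<open>p, q, r\<close>; the position without \<open>R\<close> and the dendriform identity
  used (three choices each) index the nine.  The remaining conditions, sesquilinearity and
  multiplicativity, pass to the new products because \<open>R\<close> is \<open>\<complex>[\<partial>]\<close>-linear and commutes with
  \<open>\<alpha>\<close> and \<open>\<beta>\<close>.
\<close>

text \<open>
  Applying \<open>R\<close> to the coefficients can lower the degree and so shorten the sum that defines the
  extension; the lost terms vanish as soon as \<open>X\<close> and \<open>g\<close> preserve zero.
\<close>

lemma coeffwise_map_poly:
  assumes X: "X 0 = 0" and g: "g 0 = 0" and R: "R 0 = 0"
  shows "coeffwise X g (map_poly R P) = coeffwise X (\<lambda>a. g (R a)) P"
proof -
  have X_iter: "(X ^^ i) 0 = 0" for i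
    by (induction i) (simp_all add: X)
  have "(\<Sum>i\<le>degree (map_poly R P). (X ^^ i) (g (coeff (map_poly R P) i)))
      = (\<Sum>i\<le>degree P. (X ^^ i) (g (coeff (map_poly R P) i)))"
    by (rule sum.mono_neutral_left)
      (use map_poly_degree_leq[of R P] in \<open>auto simp: X_iter g coeff_eq_0\<close>)
  then show ?thesis
    by (simp add: coeffwise_def coeff_map_poly R)
qed

lemma subst_var_0: "X 0 = 0 \<Longrightarrow> subst_var X 0 = 0"
  by (simp add: subst_var_def coeffwise_def)

lemma lext_comp_left:
  assumes "R 0 = 0" and "\<And>r. f 0 r = 0"
  shows "lext (\<lambda>p q. f (R p) q) P r = lext f (map_poly R P) r"
  unfolding lext_def using assms
  by (subst coeffwise_map_poly) (simp_all add: subst_var_0 mult_lam_mu_def mult_lam_def mult_mu_def)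

lemma lext_comp_right: "lext (\<lambda>p q. f p (R q)) P r = lext f P (R r)"
  by (simp add: lext_def)

lemma rext_comp_right:
  assumes "R 0 = 0" and "\<And>p. f p 0 = 0"
  shows "rext (\<lambda>p q. f p (R q)) p Q = rext f p (map_poly R Q)"
  unfolding rext_def using assms
  by (subst coeffwise_map_poly) (simp_all add: subst_var_0 mult_lam_def mult_mu_def)

lemma rext_comp_left: "rext (\<lambda>p q. f (R p) q) p Q = rext f (R p) Q"
  by (simp add: rext_def)

lemma map_poly_additive:
  assumes "R 0 = 0" and "\<And>a b. R (a + b) = R a + R b"
  shows "map_poly R (P + Q) = map_poly R P + map_poly R Q"
  by (rule poly_eqI) (simp add: coeff_map_poly assms)

lemma conformal_sesquilinear_zero:
  assumes "conformal_sesquilinear scale f"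
  shows "f 0 q = 0" and "f p 0 = 0"
proof -
  have "Vector_Spaces.linear (cscale scale) (poly_cscale scale) (\<lambda>p. f p q)"
    and "Vector_Spaces.linear (cscale scale) (poly_cscale scale) (\<lambda>q. f p q)"
    using assms by (simp_all add: conformal_sesquilinear_def)
  then show "f 0 q = 0" and "f p 0 = 0"
    by (auto dest!: Vector_Spaces.linear.axioms(3) dest: module_hom.zero)
qed

lemma module_hom_linear_cscale:
  assumes "module_hom scale scale R" and "vector_space (cscale scale)"
  shows "Vector_Spaces.linear (cscale scale) (cscale scale) R"
  using assms
  by (simp add: Vector_Spaces.linear_iff cscale_def module_hom_iff)

lemma conformal_sesquilinear_comp:
  assumes f: "conformal_sesquilinear scale f" and R: "module_hom scale scale R"
  shows "conformal_sesquilinear scale (\<lambda>p q. f (R p) q)"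
    and "conformal_sesquilinear scale (\<lambda>p q. f p (R q))"
proof -
  have lin: "Vector_Spaces.linear (cscale scale) (poly_cscale scale) (\<lambda>p. f p q)"
    "Vector_Spaces.linear (cscale scale) (poly_cscale scale) (\<lambda>q. f p q)" for p q
    using f by (simp_all add: conformal_sesquilinear_def)
  then have "vector_space (cscale scale)"
    by (blast dest: Vector_Spaces.linear.axioms)
  with R have R_lin: "Vector_Spaces.linear (cscale scale) (cscale scale) R"
    by (rule module_hom_linear_cscale)
  have R_partial: "R (partial_op scale p) = partial_op scale (R p)" for p
    using R by (simp add: partial_op_def module_hom.scale)
  show "conformal_sesquilinear scale (\<lambda>p q. f (R p) q)"
    and "conformal_sesquilinear scale (\<lambda>p q. f p (R q))"
    using f lin Vector_Spaces.linear_compose[OF R_lin lin(1)]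
      Vector_Spaces.linear_compose[OF R_lin lin(2)]
    by (simp_all add: conformal_sesquilinear_def R_partial o_def)
qed

lemma multiplicative_comp:
  assumes "multiplicative \<alpha> f" and "\<And>p. R (\<alpha> p) = \<alpha> (R p)"
  shows "multiplicative \<alpha> (\<lambda>p q. f (R p) q)" and "multiplicative \<alpha> (\<lambda>p q. f p (R q))"
  using assms by (simp_all add: multiplicative_def)

theorem proposition4p5:
  fixes scale :: "complex poly \<Rightarrow> 'a::ab_group_add \<Rightarrow> 'a"
    and prec succ :: "'a \<Rightarrow> 'a \<Rightarrow> 'a poly"
    and \<alpha> \<beta> R :: "'a \<Rightarrow> 'a"
  assumes "bihom_dendriform_conformal scale prec succ \<alpha> \<beta>"
    and "rota_baxter_weight_0 scale prec succ \<alpha> \<beta> R"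
  shows "bihom_quadri_conformal scale
    (\<lambda>p q. prec p (R q)) (\<lambda>p q. prec (R p) q) (\<lambda>p q. succ p (R q)) (\<lambda>p q. succ (R p) q) \<alpha> \<beta>"
proof -
  interpret D: bihom_dendriform_conformal scale prec succ \<alpha> \<beta> by fact
  interpret R: rota_baxter_weight_0 scale prec succ \<alpha> \<beta> R by fact
  have R: "module_hom scale scale R"
    by (rule R.module_hom_axioms)
  note zero = conformal_sesquilinear_zero[OF D.sesquilinear_prec]
    conformal_sesquilinear_zero[OF D.sesquilinear_succ]
  note ext = lext_comp_left[where R = R and f = prec, OF R.zero zero(1)]
    lext_comp_left[where R = R and f = succ, OF R.zero zero(3)]
    lext_comp_right[where R = R and f = prec] lext_comp_right[where R = R and f = succ]
    rext_comp_left[where R = R and f = prec] rext_comp_left[where R = R and f = succ]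
    rext_comp_right[where R = R and f = prec, OF R.zero zero(2)]
    rext_comp_right[where R = R and f = succ, OF R.zero zero(4)]
  have add: "map_poly R (P + Q) = map_poly R P + map_poly R Q" for P Q
    by (rule map_poly_additive) (simp_all add: R.add)
  note sesquilinear = conformal_sesquilinear_comp[OF D.sesquilinear_prec R]
    conformal_sesquilinear_comp[OF D.sesquilinear_succ R]
  note multiplicative = multiplicative_comp[where R = R and \<alpha> = \<alpha>, OF _ R.R_alpha]
    multiplicative_comp[where R = R and \<alpha> = \<beta>, OF _ R.R_beta]
  \<comment> \<open>The nine identities are grouped by the argument that carries no \<open>R\<close>: first \<open>p\<close>, then \<open>q\<close>, then \<open>r\<close>.\<close>
  show ?thesis
  proof (unfold_locales, unfold ext R.R_alpha R.R_beta)
    fix p q r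
    show "lext prec (prec p (R q)) (\<beta> (R r)) =
        rext prec (\<alpha> p) (map_poly R (prec q (R r) + prec (R q) r + succ q (R r) + succ (R q) r))"
      using D.prec_prec[of p "R q" "R r"] by (simp add: add R.R_prec R.R_succ ac_simps)
    show "lext prec (succ p (R q)) (\<beta> (R r)) =
        rext succ (\<alpha> p) (map_poly R (prec q (R r) + prec (R q) r))"
      using D.succ_prec[of p "R q" "R r"] by (simp add: add R.R_prec ac_simps)
    show "lext succ (succ p (R q) + prec p (R q)) (\<beta> (R r)) =
        rext succ (\<alpha> p) (map_poly R (succ q (R r) + succ (R q) r))"
      using D.succ_succ[of p "R q" "R r"] by (simp add: add R.R_succ ac_simps)
    show "lext prec (prec (R p) q) (\<beta> (R r)) =
        rext prec (\<alpha> (R p)) (succ q (R r) + prec q (R r))"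
      using D.prec_prec[of "R p" q "R r"] by (simp add: ac_simps)
    show "lext succ (succ (R p) q + prec (R p) q) (\<beta> (R r)) =
        rext succ (\<alpha> (R p)) (succ q (R r))"
      using D.succ_succ[of "R p" q "R r"] by (simp add: ac_simps)
    show "lext prec (succ (R p) q) (\<beta> (R r)) = rext succ (\<alpha> (R p)) (prec q (R r))"
      by (rule D.succ_prec)
    show "lext prec (map_poly R (prec p (R q) + prec (R p) q)) (\<beta> r) =
        rext prec (\<alpha> (R p)) (succ (R q) r + prec (R q) r)"
      using D.prec_prec[of "R p" "R q" r] by (simp add: add R.R_prec ac_simps)
    show "lext succ (map_poly R (prec p (R q) + prec (R p) q + succ p (R q) + succ (R p) q)) (\<beta> r) =
        rext succ (\<alpha> (R p)) (succ (R q) r)"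
      using D.succ_succ[of "R p" "R q" r] by (simp add: add R.R_prec R.R_succ ac_simps)
    show "lext prec (map_poly R (succ p (R q) + succ (R p) q)) (\<beta> r) =
        rext succ (\<alpha> (R p)) (prec (R q) r)"
      using D.succ_prec[of "R p" "R q" r] by (simp add: add R.R_succ ac_simps)
  qed (intro sesquilinear multiplicative D.multiplicative_alpha D.multiplicative_beta)+
qed

end
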